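(* Let $n\ge2$ and let $X$ be a tight harmonic index $4$-design on $S^{n-1}$. Then $n=2$, or there is an odd integer $p\ge5$ such that $n=3p^2-4$.
   Context: $S^{n-1}$ denotes the unit sphere centered at the origin in $\mathbb{R}^n$. $\mathrm{Harm}_t(\mathbb{R}^n)$ is the space of real homogeneous polynomials $f$ of degree $t$ in $n$ variables with $\Delta f=0$, where $\Delta=\sum_i\partial^2/\partial x_i^2$. A finite nonempty subset $X\subset S^{n-1}$ is a spherical design of harmonic index $t$ (harmonic index $t$-design) if $\sum_{x\in X}f(x)=0$ for every $f\in\mathrm{Harm}_t(\mathbb{R}^n)$. $Q_{n,t}$: let $C_t^\lambda(x)$ be the Gegenbauer polynomial of degree $t$, defined for $\lambda\ne0$ by $(1-2xr+r^2)^{-\lambda}=\sum_{t\ge0}C_t^\lambda(x)r^t$, and for $\lambda=0$ by the Chebyshev polynomial of the first kind $C_t^0(x)=\cos(t\arccos x)$. Then $Q_{n,t}(x)=A_{n,t}C_t^{(n-2)/2}(x)$, where the constant $A_{n,t}$ is chosen so that $Q_{n,t}(1)=\binom{n+t-1}{t}-\binom{n+t-3}{t-2}$. Put $c_{n,t}=-\min_{-1\le x\le1}Q_{n,t}(x)>0$ and $b_{n,t}=1+\frac1{c_{n,t}}\left\{\binom{n+t-1}{t}-\binom{n+t-3}{t-2}\right\}$. A harmonic index $t$-design $X$ on $S^{n-1}$ is called tight if $b_{n,t}$ is an integer and $|X|=b_{n,t}$. *)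

theory Defs
  imports "HOL-Analysis.Analysis" "HOL-Computational_Algebra.Formal_Power_Series"
begin

definition partial_deriv :: "'n::finite \<Rightarrow> (real ^ 'n \<Rightarrow> real) \<Rightarrow> real ^ 'n \<Rightarrow> real" where
  "partial_deriv i f x = deriv (\<lambda>s. f (x + s *\<^sub>R axis i 1)) 0"

definition laplacian :: "(real ^ 'n::finite \<Rightarrow> real) \<Rightarrow> real ^ 'n \<Rightarrow> real" where
  "laplacian f x = (\<Sum>i\<in>UNIV. partial_deriv i (partial_deriv i f) x)"

text \<open>Real polynomials are identified with the functions they induce, which is harmless because
  the field is infinite. The index set below consists of the exponent vectors of the monomials of
  total degree \<open>t\<close>; it is finite.\<close>

definition homogeneous_polynomial :: "nat \<Rightarrow> (real ^ 'n::finite \<Rightarrow> real) \<Rightarrow> bool" where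
  "homogeneous_polynomial t f \<longleftrightarrow>
     (\<exists>c :: ('n \<Rightarrow> nat) \<Rightarrow> real.
        \<forall>x. f x = (\<Sum>\<alpha> | (\<Sum>i\<in>UNIV. \<alpha> i) = t. c \<alpha> * (\<Prod>i\<in>UNIV. (x $ i) ^ \<alpha> i)))"

definition Harm :: "nat \<Rightarrow> (real ^ 'n::finite \<Rightarrow> real) set" where
  "Harm t = {f. homogeneous_polynomial t f \<and> (\<forall>x. laplacian f x = 0)}"

definition harmonic_index_design :: "nat \<Rightarrow> (real ^ 'n::finite) set \<Rightarrow> bool" where
  "harmonic_index_design t X \<longleftrightarrow>
     finite X \<and> X \<noteq> {} \<and> X \<subseteq> sphere 0 1 \<and> (\<forall>f\<in>Harm t. (\<Sum>x\<in>X. f x) = 0)"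

text \<open>For \<open>l \<noteq> 0\<close> this is the coefficient of \<open>r ^ t\<close> in \<open>(1 - 2 x r + r\<^sup>2) powr (- l)\<close>, obtained by
  substituting \<open>r\<^sup>2 - 2 x r\<close> (which has zero constant term) into the binomial series of \<open>1 + r\<close> with
  exponent \<open>- l\<close>. For \<open>l = 0\<close> it is the Chebyshev polynomial of the first kind; there the formula is
  only meaningful for \<open>-1 \<le> x \<le> 1\<close>, and only these arguments are used.\<close>

definition gegenbauer :: "real \<Rightarrow> nat \<Rightarrow> real \<Rightarrow> real" where
  "gegenbauer l t x =
     (if l = 0 then cos (real t * arccos x)
      else fps_nth (fps_binomial (- l) oo (fps_X ^ 2 - fps_const (2 * x) * fps_X)) t)"

text \<open>The case distinction implements the convention that binomial coefficients with negative lower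
  argument vanish.\<close>

definition harm_dim :: "nat \<Rightarrow> nat \<Rightarrow> real" where
  "harm_dim n t =
     real ((n + t - 1) choose t) - (if t < 2 then 0 else real ((n + t - 3) choose (t - 2)))"

text \<open>The factor in front of the Gegenbauer polynomial is the one for which
  \<open>Q_poly n t 1 = harm_dim n t\<close>.\<close>

definition Q_poly :: "nat \<Rightarrow> nat \<Rightarrow> real \<Rightarrow> real" where
  "Q_poly n t x =
     harm_dim n t / gegenbauer ((real n - 2) / 2) t 1 * gegenbauer ((real n - 2) / 2) t x"

definition c_const :: "nat \<Rightarrow> nat \<Rightarrow> real" where
  "c_const n t = - (LEAST y. y \<in> Q_poly n t ` {-1..1})"

definition b_const :: "nat \<Rightarrow> nat \<Rightarrow> real" where
  "b_const n t = 1 + 1 / c_const n t * harm_dim n t"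

definition tight_harmonic_index_design :: "nat \<Rightarrow> (real ^ 'n::finite) set \<Rightarrow> bool" where
  "tight_harmonic_index_design t X \<longleftrightarrow>
     harmonic_index_design t X \<and> b_const CARD('n) t \<in> \<int> \<and> real (card X) = b_const CARD('n) t"

end

theory Submission
  imports Defs
begin

text \<open>For \<open>n \<ge> 3\<close> the polynomial \<open>Q\<^sub>n\<^sub>,\<^sub>4\<close> attains its minimum on \<open>[-1, 1]\<close> exactly where
  \<open>x\<^sup>2 = 3 / (n + 4)\<close>. Summing the zonal harmonics \<open>Q\<^sub>n\<^sub>,\<^sub>4 (x \<bullet> y)\<close> over a tight design shows
  that all inner products of distinct points attain this minimum, so the points span
  \<open>N = (n + 1) (n + 2) / 6\<close> equiangular lines with \<open>x \<bullet> y = \<plusminus> 1 / \<beta>\<close> and \<open>\<beta>\<^sup>2 = (n + 4) / 3\<close>.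

  As \<open>N > n\<close>, some three of the lines carry unit vectors with pairwise inner product \<open>- 1 / \<beta>\<close>, which
  forces \<open>\<beta> \<ge> 2\<close>. The matrix of signs has eigenvalue \<open>- \<beta>\<close> with multiplicity at least \<open>N - n\<close>; if
  \<open>\<beta>\<close> were irrational, its conjugate would have the same multiplicity, so \<open>N \<le> 2 n\<close>. Hence \<open>\<beta>\<close> is
  rational, and reducing a primitive integral eigenvector modulo the denominator of \<open>\<beta>\<close> and modulo \<open>2\<close>
  shows that \<open>\<beta>\<close> is an odd integer. The value \<open>\<beta> = 3\<close> means 100 lines in dimension 23, while
  there are at most 50 such lines with angle \<open>arccos (1 / 3)\<close>.\<close>

section \<open>Zonal quartics\<close>

abbreviation monomial :: "('n::finite \<Rightarrow> nat) \<Rightarrow> real ^ 'n \<Rightarrow> real" where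
  "monomial \<alpha> x \<equiv> (\<Prod>i\<in>UNIV. (x $ i) ^ \<alpha> i)"

lemma finite_exponents: "finite {\<alpha> :: 'n::finite \<Rightarrow> nat. (\<Sum>i\<in>UNIV. \<alpha> i) = t}"
proof (rule finite_subset)
  show "{\<alpha> :: 'n \<Rightarrow> nat. (\<Sum>i\<in>UNIV. \<alpha> i) = t} \<subseteq> (\<Pi>\<^sub>E i\<in>UNIV. {..t})"
  proof
    fix \<alpha> :: "'n \<Rightarrow> nat"
    assume "\<alpha> \<in> {\<alpha>. (\<Sum>i\<in>UNIV. \<alpha> i) = t}"
    then have "\<alpha> i \<le> t" for i
      using member_le_sum[of i UNIV \<alpha>] by auto
    then show "\<alpha> \<in> (\<Pi>\<^sub>E i\<in>UNIV. {..t})" by auto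
  qed
qed (simp add: finite_PiE)

lemma homogeneous_polynomialE:
  assumes "homogeneous_polynomial t f"
  obtains c where "f = (\<lambda>x. \<Sum>\<alpha> | (\<Sum>i\<in>UNIV. \<alpha> i) = t. c \<alpha> * monomial \<alpha> x)"
  using assms that unfolding homogeneous_polynomial_def fun_eq_iff by blast

lemma homogeneous_polynomial_0: "homogeneous_polynomial t (\<lambda>x. 0)"
  unfolding homogeneous_polynomial_def by (rule exI[of _ "\<lambda>_. 0"]) simp

lemma homogeneous_polynomial_monomial:
  assumes "(\<Sum>i\<in>UNIV. \<alpha> i) = t"
  shows "homogeneous_polynomial t (monomial \<alpha>)"
  unfolding homogeneous_polynomial_def
proof (intro exI allI)
  fix x :: "real ^ 'a"
  show "monomial \<alpha> x = (\<Sum>\<gamma> | (\<Sum>i\<in>UNIV. \<gamma> i) = t. (if \<gamma> = \<alpha> then 1 else 0) * monomial \<gamma> x)"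
    using assms by (simp add: finite_exponents if_distrib[of "\<lambda>u. u * _"] cong: if_cong)
qed

lemma homogeneous_polynomial_add:
  assumes "homogeneous_polynomial t f" "homogeneous_polynomial t g"
  shows "homogeneous_polynomial t (\<lambda>x. f x + g x)"
proof -
  obtain c where "f = (\<lambda>x. \<Sum>\<alpha> | (\<Sum>i\<in>UNIV. \<alpha> i) = t. c \<alpha> * monomial \<alpha> x)"
    using assms(1) by (rule homogeneous_polynomialE)
  moreover obtain d where "g = (\<lambda>x. \<Sum>\<alpha> | (\<Sum>i\<in>UNIV. \<alpha> i) = t. d \<alpha> * monomial \<alpha> x)"
    using assms(2) by (rule homogeneous_polynomialE)
  ultimately have "f x + g x = (\<Sum>\<alpha> | (\<Sum>i\<in>UNIV. \<alpha> i) = t. (c \<alpha> + d \<alpha>) * monomial \<alpha> x)" for x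
    by (simp add: sum.distrib distrib_right)
  then show ?thesis unfolding homogeneous_polynomial_def by (intro exI[of _ "\<lambda>\<alpha>. c \<alpha> + d \<alpha>"]) simp
qed

lemma homogeneous_polynomial_cmult:
  assumes "homogeneous_polynomial t f"
  shows "homogeneous_polynomial t (\<lambda>x. a * f x)"
proof -
  obtain c where "f = (\<lambda>x. \<Sum>\<alpha> | (\<Sum>i\<in>UNIV. \<alpha> i) = t. c \<alpha> * monomial \<alpha> x)"
    using assms by (rule homogeneous_polynomialE)
  then show ?thesis unfolding homogeneous_polynomial_def
    by (intro exI[of _ "\<lambda>\<alpha>. a * c \<alpha>"]) (simp add: sum_distrib_left mult.assoc)
qed

lemma homogeneous_polynomial_sum:
  assumes "\<And>i. i \<in> I \<Longrightarrow> homogeneous_polynomial t (f i)"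
  shows "homogeneous_polynomial t (\<lambda>x. \<Sum>i\<in>I. f i x)"
  using assms
  by (induction I rule: infinite_finite_induct)
     (auto intro: homogeneous_polynomial_0 homogeneous_polynomial_add)

lemma homogeneous_polynomial_mult:
  assumes "homogeneous_polynomial s f" "homogeneous_polynomial t g"
  shows "homogeneous_polynomial (s + t) (\<lambda>x. f x * g x)"
proof -
  obtain c where c: "f = (\<lambda>x. \<Sum>\<alpha> | (\<Sum>i\<in>UNIV. \<alpha> i) = s. c \<alpha> * monomial \<alpha> x)"
    using assms(1) by (rule homogeneous_polynomialE)
  obtain d where d: "g = (\<lambda>x. \<Sum>\<alpha> | (\<Sum>i\<in>UNIV. \<alpha> i) = t. d \<alpha> * monomial \<alpha> x)"
    using assms(2) by (rule homogeneous_polynomialE)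
  have "f x * g x = (\<Sum>\<alpha> | (\<Sum>i\<in>UNIV. \<alpha> i) = s. \<Sum>\<gamma> | (\<Sum>i\<in>UNIV. \<gamma> i) = t.
      (c \<alpha> * d \<gamma>) * monomial (\<lambda>i. \<alpha> i + \<gamma> i) x)" for x
    unfolding c d sum_product
    by (intro sum.cong refl) (simp add: power_add prod.distrib mult_ac)
  moreover have "homogeneous_polynomial (s + t) (\<lambda>x. \<Sum>\<alpha> | (\<Sum>i\<in>UNIV. \<alpha> i) = s.
      \<Sum>\<gamma> | (\<Sum>i\<in>UNIV. \<gamma> i) = t. (c \<alpha> * d \<gamma>) * monomial (\<lambda>i. \<alpha> i + \<gamma> i) x)"
    by (intro homogeneous_polynomial_sum homogeneous_polynomial_cmult
        homogeneous_polynomial_monomial) (auto simp: sum.distrib)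
  ultimately show ?thesis by simp
qed

lemma homogeneous_polynomial_nth: "homogeneous_polynomial 1 (\<lambda>x. x $ i)"
proof -
  have "(x $ i) = monomial (\<lambda>j. if j = i then 1 else 0) x" for x :: "real ^ 'a"
  proof -
    have "monomial (\<lambda>j. if j = i then 1 else 0) x = (\<Prod>j\<in>UNIV. if j = i then x $ j else 1)"
      by (intro prod.cong) auto
    then show ?thesis by simp
  qed
  then show ?thesis
    using homogeneous_polynomial_monomial[of "\<lambda>j. if j = i then 1 else 0" 1] by simp
qed

section \<open>Zonal functions and their Laplacian\<close>

lemma homogeneous_polynomial_inner:
  fixes y :: "real ^ 'n::finite"
  shows "homogeneous_polynomial 1 (\<lambda>x. x \<bullet> y)"
proof -
  have "homogeneous_polynomial 1 (\<lambda>x. \<Sum>i\<in>UNIV. y $ i * x $ i)"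
    by (intro homogeneous_polynomial_sum homogeneous_polynomial_cmult homogeneous_polynomial_nth)
  then show ?thesis by (simp add: inner_vec_def mult.commute)
qed

lemma homogeneous_polynomial_inner_self:
  "homogeneous_polynomial 2 (\<lambda>x :: real ^ 'n::finite. x \<bullet> x)"
proof -
  have "homogeneous_polynomial (1 + 1) (\<lambda>x :: real ^ 'n. \<Sum>i\<in>UNIV. x $ i * x $ i)"
    by (intro homogeneous_polynomial_sum homogeneous_polynomial_mult homogeneous_polynomial_nth)
  then show ?thesis by (simp add: inner_vec_def numeral_2_eq_2)
qed

text \<open>The powers of \<open>x \<bullet> x\<close> make this homogeneous of degree 4; on the
  unit sphere it restricts to \<open>t ^ 4 - a * t\<^sup>2 + b\<close> with
  \<open>t = x \<bullet> y\<close>.\<close>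

definition zonal :: "real \<Rightarrow> real \<Rightarrow> real ^ 'n::finite \<Rightarrow> real ^ 'n \<Rightarrow> real" where
  "zonal a b y x = (x \<bullet> y) ^ 4 - a * ((x \<bullet> y)\<^sup>2 * (x \<bullet> x)) + b * (x \<bullet> x)\<^sup>2"

lemma homogeneous_polynomial_zonal: "homogeneous_polynomial 4 (zonal a b y)"
proof -
  note h1 = homogeneous_polynomial_inner[of y]
  have 1: "homogeneous_polynomial 2 (\<lambda>x. (x \<bullet> y)\<^sup>2)"
    using homogeneous_polynomial_mult[OF h1 h1] by (simp add: power2_eq_square numeral_2_eq_2)
  have 2: "homogeneous_polynomial 4 (\<lambda>x. (x \<bullet> y) ^ 4)"
    using homogeneous_polynomial_mult[OF 1 1] by (simp add: power_add[symmetric])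
  have 3: "homogeneous_polynomial 4 (\<lambda>x. (x \<bullet> y)\<^sup>2 * (x \<bullet> x))"
    using homogeneous_polynomial_mult[OF 1 homogeneous_polynomial_inner_self] by simp
  have 4: "homogeneous_polynomial 4 (\<lambda>x :: real ^ 'a. (x \<bullet> x)\<^sup>2)"
    using homogeneous_polynomial_mult[OF homogeneous_polynomial_inner_self
        homogeneous_polynomial_inner_self] by (simp add: power2_eq_square)
  have "homogeneous_polynomial 4
      (\<lambda>x. ((x \<bullet> y) ^ 4 + (- a) * ((x \<bullet> y)\<^sup>2 * (x \<bullet> x))) + b * (x \<bullet> x)\<^sup>2)"
    by (intro homogeneous_polynomial_add homogeneous_polynomial_cmult 2 3 4)
  then show ?thesis by (simp add: zonal_def[abs_def])
qed

text \<open>Along a coordinate line every ingredient of \<open>zonal\<close> is a polynomial in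
  \<open>s\<close>, so partial derivatives become one-variable derivatives at
  \<open>s = 0\<close>.\<close>

lemma inner_line:
  fixes x y :: "real ^ 'n::finite"
  shows "(x + s *\<^sub>R axis i 1) \<bullet> y = x \<bullet> y + s * y $ i"
    and "(x + s *\<^sub>R axis i 1) \<bullet> (x + s *\<^sub>R axis i 1) = x \<bullet> x + 2 * s * x $ i + s\<^sup>2"
    and "(x + s *\<^sub>R axis i 1) $ i = x $ i + s"
  by (simp_all add: inner_add_left inner_add_right inner_axis inner_axis' power2_eq_square
      inner_commute algebra_simps)

lemma partial_deriv_zonal:
  "partial_deriv i (zonal a b y) x = 4 * (x \<bullet> y) ^ 3 * y $ i
     - a * (2 * (x \<bullet> y) * y $ i * (x \<bullet> x) + 2 * (x \<bullet> y)\<^sup>2 * x $ i) + 4 * b * (x \<bullet> x) * x $ i"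
  unfolding partial_deriv_def zonal_def inner_line
  by (rule DERIV_imp_deriv)
     (auto intro!: derivative_eq_intros simp: inner_axis algebra_simps power2_eq_square power3_eq_cube)

lemma partial_deriv_2_zonal:
  "partial_deriv i (partial_deriv i (zonal a b y)) x = 12 * (x \<bullet> y)\<^sup>2 * (y $ i)\<^sup>2
     - a * (2 * (y $ i)\<^sup>2 * (x \<bullet> x) + 8 * (x \<bullet> y) * (y $ i * x $ i) + 2 * (x \<bullet> y)\<^sup>2)
     + 4 * b * (2 * (x $ i)\<^sup>2 + x \<bullet> x)"
  unfolding partial_deriv_def[of i "partial_deriv i (zonal a b y)"] partial_deriv_zonal inner_line
  by (rule DERIV_imp_deriv)
     (auto intro!: derivative_eq_intros simp: inner_axis algebra_simps power2_eq_square power3_eq_cube)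

lemma laplacian_zonal:
  fixes y :: "real ^ 'n::finite"
  shows "laplacian (zonal a b y) x =
     (12 * (y \<bullet> y) - a * (8 + 2 * real CARD('n))) * (x \<bullet> y)\<^sup>2
     + (4 * b * (2 + real CARD('n)) - 2 * a * (y \<bullet> y)) * (x \<bullet> x)"
proof -
  have [simp]: "(\<Sum>i\<in>UNIV. (v $ i)\<^sup>2) = v \<bullet> v" for v :: "real ^ 'n"
    by (simp add: inner_vec_def power2_eq_square)
  have [simp]: "(\<Sum>i\<in>UNIV. y $ i * x $ i) = x \<bullet> y"
    by (simp add: inner_vec_def mult.commute)
  show ?thesis
    unfolding laplacian_def partial_deriv_2_zonal
    by (simp add: sum.distrib sum_subtractf sum_distrib_left[symmetric] sum_distrib_right[symmetric])
       (simp add: algebra_simps power2_eq_square)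
qed

section \<open>The degree four Gegenbauer polynomial and the size of a tight design\<close>

definition quartic :: "real \<Rightarrow> real \<Rightarrow> real" where
  "quartic m x = x ^ 4 - 6 / (m + 4) * x\<^sup>2 + 3 / ((m + 2) * (m + 4))"

lemma harmonic_index_4_design_quartic:
  fixes X :: "(real ^ 'n::finite) set"
  assumes "harmonic_index_design 4 X" "norm y = 1"
  shows "(\<Sum>x\<in>X. quartic (real CARD('n)) (x \<bullet> y)) = 0"
proof -
  define n where "n = real CARD('n)"
  have n: "n > 0" by (simp add: n_def)
  \<comment> \<open>For a unit vector \<open>y\<close> these are the values of \<open>a\<close> and
    \<open>b\<close> at which both coefficients in \<open>laplacian_zonal\<close> vanish.\<close>
  let ?f = "zonal (6 / (n + 4)) (3 / ((n + 2) * (n + 4))) y"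
  have "y \<bullet> y = 1" using assms(2) by (simp add: dot_square_norm)
  then have "laplacian ?f x = 0" for x
    using n unfolding laplacian_zonal n_def[symmetric]
    by (simp add: divide_simps)
  then have "?f \<in> Harm 4" by (simp add: Harm_def homogeneous_polynomial_zonal)
  then have "(\<Sum>x\<in>X. ?f x) = 0" using assms(1) by (simp add: harmonic_index_design_def)
  moreover have "?f x = quartic n (x \<bullet> y)" if "x \<in> X" for x
  proof -
    have "norm x = 1" using assms(1) that by (auto simp: harmonic_index_design_def)
    then have "x \<bullet> x = 1" by (simp add: dot_square_norm)
    then show ?thesis by (simp add: zonal_def quartic_def)
  qed
  ultimately show ?thesis by (simp add: n_def)
qed

text \<open>Completing the square exhibits the minimum, taken where
  \<open>x\<^sup>2 = 3 / (m + 4)\<close>.\<close>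

lemma quartic_eq:
  assumes "m > 0"
  shows "quartic m x = (x\<^sup>2 - 3 / (m + 4))\<^sup>2 - 6 * (m + 1) / ((m + 2) * (m + 4)\<^sup>2)"
proof -
  have "6 * (m + 1) / ((m + 2) * (m + 4)\<^sup>2) = 9 / (m + 4)\<^sup>2 - 3 / ((m + 2) * (m + 4))"
    using assms by (simp add: divide_simps) (simp add: algebra_simps power2_eq_square)
  then show ?thesis by (simp add: quartic_def power2_diff power_divide)
qed

lemma quartic_1:
  assumes "m > 0"
  shows "quartic m 1 = (m\<^sup>2 - 1) / ((m + 2) * (m + 4))"
  using assms by (simp add: quartic_def divide_simps) (simp add: algebra_simps power2_eq_square)

lemma gegenbauer_4:
  assumes "l > 0"
  shows "gegenbauer l 4 x = 2 / 3 * (l * (l + 1) * (l + 2) * (l + 3)) * quartic (2 * l + 2) x"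
proof -
  let ?a = "fps_X ^ 2 - fps_const (2 * x) * fps_X :: real fps"
  have a: "?a = fps_X * (fps_X - fps_const (2 * x))"
    by (simp add: power2_eq_square algebra_simps)
  \<comment> \<open>By the factor \<open>fps_X\<close>, the power \<open>?a ^ i\<close> starts in
    degree \<open>i\<close> at the earliest, so only \<open>i \<le> 4\<close> matter; of these,
    \<open>i = 0\<close> and \<open>i = 1\<close> contribute nothing in degree 4.\<close>
  have "fps_nth (?a ^ i) 4 =
      (if i = 2 then 1 else if i = 3 then 12 * x\<^sup>2 else if i = 4 then 16 * x ^ 4 else 0)"
    if "i \<le> 4" for i
  proof -
    have "fps_nth (?a ^ i) 4 = fps_nth ((fps_X - fps_const (2 * x)) ^ i) (4 - i)"
      unfolding a power_mult_distrib using that by (simp add: fps_X_power_mult_nth)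
    moreover from that have "i = 0 \<or> i = 1 \<or> i = 2 \<or> i = 3 \<or> i = 4" by linarith
    ultimately show ?thesis
      by (auto simp: fps_mult_nth power2_eq_square power3_eq_cube numeral_eq_Suc)
  qed
  then have "gegenbauer l 4 x = (\<Sum>i\<le>4. ((- l) gchoose i) *
      (if i = 2 then 1 else if i = 3 then 12 * x\<^sup>2 else if i = 4 then 16 * x ^ 4 else 0))"
    using assms unfolding gegenbauer_def fps_compose_nth fps_binomial_nth atMost_atLeast0
    by simp
  also have "\<dots> = ((- l) gchoose 2) + ((- l) gchoose 3) * (12 * x\<^sup>2) + ((- l) gchoose 4) * (16 * x ^ 4)"
    by (simp add: numeral_eq_Suc)
  also have "\<dots> = 2 / 3 * (l * (l + 1) * (l + 2) * (l + 3)) * quartic (2 * l + 2) x"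
  proof -
    have gchoose: "(- l) gchoose 2 = l * (l + 1) / 2" "(- l) gchoose 3 = - (l * (l + 1) * (l + 2)) / 6"
      "(- l) gchoose 4 = l * (l + 1) * (l + 2) * (l + 3) / 24"
      by (simp_all add: gbinomial_prod_rev numeral_eq_Suc fact_numeral algebra_simps)
    show ?thesis
      unfolding gchoose using assms by (simp add: quartic_def divide_simps)
        (simp add: algebra_simps power2_eq_square power4_eq_xxxx)
  qed
  finally show ?thesis .
qed

lemma harm_dim_4_pos:
  assumes "n \<ge> 2"
  shows "harm_dim n 4 > 0"
proof -
  have *: "real (m choose k) = (real m gchoose k)" for m k by (simp add: binomial_gbinomial)
  have "harm_dim n 4 = real n * (real n + 1) * ((real n + 2) * (real n + 3) - 12) / 24"
    unfolding harm_dim_def * using assms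
    by (simp add: gbinomial_prod_rev numeral_eq_Suc fact_numeral of_nat_diff field_simps)
  moreover
  have "(real n + 2) * (real n + 3) \<ge> 4 * 5" using assms by (intro mult_mono) auto
  then have "real n * (real n + 1) * ((real n + 2) * (real n + 3) - 12) > 0"
    using assms by (intro mult_pos_pos) auto
  ultimately show ?thesis by simp
qed

text \<open>For \<open>n \<ge> 3\<close> the Gegenbauer parameter is positive, and the constant in
  front of the quartic cancels against the same constant in the value at \<open>1\<close>.\<close>

lemma Q_poly_4:
  assumes "n \<ge> 3"
  shows "Q_poly n 4 x = harm_dim n 4 / quartic (real n) 1 * quartic (real n) x"
proof -
  define l where "l = (real n - 2) / 2"
  have "l > 0" "2 * l + 2 = real n" using assms by (auto simp: l_def field_simps)
  then show ?thesis unfolding Q_poly_def l_def[symmetric] by (simp add: gegenbauer_4)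
qed

lemma quartic_1_pos: "m > 1 \<Longrightarrow> quartic m 1 > 0"
  by (simp add: quartic_1 one_less_power)

lemma c_const_4:
  assumes "n \<ge> 3"
  shows "c_const n 4 = harm_dim n 4 / quartic (real n) 1
    * (6 * (real n + 1) / ((real n + 2) * (real n + 4)\<^sup>2))"
proof -
  define k where "k = harm_dim n 4 / quartic (real n) 1"
  define q where "q = 6 * (real n + 1) / ((real n + 2) * (real n + 4)\<^sup>2)"
  have "k > 0"
    using assms harm_dim_4_pos[of n] quartic_1_pos[of "real n"] by (simp add: k_def)
  have Q: "Q_poly n 4 x = k * ((x\<^sup>2 - 3 / (real n + 4))\<^sup>2 - q)" for x
    using assms by (simp add: Q_poly_4 k_def q_def quartic_eq)
  have "(LEAST y. y \<in> Q_poly n 4 ` {-1..1}) = - (k * q)"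
  proof (rule Least_equality)
    \<comment> \<open>The point where the square vanishes must lie in the interval, so that
      \<open>LEAST\<close> is attained there.\<close>
    have "sqrt (3 / (real n + 4)) \<le> 1" by (subst real_sqrt_le_1_iff) simp
    moreover have "0 \<le> sqrt (3 / (real n + 4))" by simp
    ultimately have "sqrt (3 / (real n + 4)) \<in> {-1..1}" by (auto intro: order_trans[of "-1" 0])
    moreover have "Q_poly n 4 (sqrt (3 / (real n + 4))) = - (k * q)" by (simp add: Q)
    ultimately show "- (k * q) \<in> Q_poly n 4 ` {-1..1}" by (metis imageI)
    show "- (k * q) \<le> y" if "y \<in> Q_poly n 4 ` {-1..1}" for y
      using that \<open>k > 0\<close> by (auto simp: Q algebra_simps)
  qed
  then show ?thesis by (simp add: c_const_def k_def q_def)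
qed

text \<open>The dimension cancels: what remains is one plus the quotient of the value of the quartic
  at \<open>1\<close> by the absolute value of its minimum.\<close>

lemma b_const_4:
  assumes "n \<ge> 3"
  shows "b_const n 4 = (real n + 1) * (real n + 2) / 6"
proof -
  define m where "m = real n"
  have m: "m \<ge> 3" using assms by (simp add: m_def)
  have "b_const n 4 = 1 + quartic m 1 * ((m + 2) * (m + 4)\<^sup>2) / (6 * (m + 1))"
    using harm_dim_4_pos[of n] assms quartic_1_pos[of m] m
    unfolding b_const_def c_const_4[OF assms] m_def[symmetric] by simp
  also have "\<dots> = (m + 1) * (m + 2) / 6"
    using m by (simp add: quartic_1 divide_simps) (simp add: algebra_simps power2_eq_square)
  finally show ?thesis by (simp add: m_def)
qed

text \<open>The distribution with respect to a point of the design contains the value at \<open>1\<close> once, and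
  the cardinality is such that all the other values have to be the minimum of the quartic.\<close>

lemma tight_harmonic_index_4_design_inner:
  fixes X :: "(real ^ 'n::finite) set"
  assumes n: "CARD('n) \<ge> 3" and X: "tight_harmonic_index_design 4 X"
    and xy: "x \<in> X" "y \<in> X" "x \<noteq> y"
  shows "(x \<bullet> y)\<^sup>2 = 3 / (real CARD('n) + 4)"
proof -
  define m where "m = real CARD('n)"
  have m: "m \<ge> 3" using n by (simp add: m_def)
  have design: "harmonic_index_design 4 X" and card: "real (card X) = (m + 1) * (m + 2) / 6"
    using X n by (auto simp: tight_harmonic_index_design_def b_const_4 m_def)
  have fin: "finite X" and norm: "z \<in> X \<Longrightarrow> norm z = 1" for z
    using design by (auto simp: harmonic_index_design_def)
  define q where "q = 6 * (m + 1) / ((m + 2) * (m + 4)\<^sup>2)"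
  have eq: "quartic m z = (z\<^sup>2 - 3 / (m + 4))\<^sup>2 - q" for z
    using m by (simp add: quartic_eq q_def)
  have "0 = (\<Sum>z\<in>X. quartic m (z \<bullet> y))"
    using harmonic_index_4_design_quartic[OF design norm[OF xy(2)]] by (simp add: m_def)
  also have "\<dots> = quartic m (y \<bullet> y) + (\<Sum>z\<in>X - {y}. quartic m (z \<bullet> y))"
    using fin xy by (subst sum.remove[of X y]) auto
  also have "y \<bullet> y = 1" using norm[OF xy(2)] by (simp add: dot_square_norm)
  also have "(\<Sum>z\<in>X - {y}. quartic m (z \<bullet> y)) =
      (\<Sum>z\<in>X - {y}. ((z \<bullet> y)\<^sup>2 - 3 / (m + 4))\<^sup>2) - (real (card X) - 1) * q"
    using fin xy card_Suc_Diff1[OF fin xy(2)] by (simp add: eq sum_subtractf flip: of_nat_Suc)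
  \<comment> \<open>Here the cardinality enters: it makes the constant terms cancel and leaves a
    vanishing sum of squares.\<close>
  also have "(real (card X) - 1) * q = quartic m 1"
    using m unfolding card q_def by (simp add: quartic_1 divide_simps)
      (simp add: algebra_simps power2_eq_square)
  finally have "(\<Sum>z\<in>X - {y}. ((z \<bullet> y)\<^sup>2 - 3 / (m + 4))\<^sup>2) = 0" by simp
  then have "\<forall>z\<in>X - {y}. ((z \<bullet> y)\<^sup>2 - 3 / (m + 4))\<^sup>2 = 0"
    using fin by (subst (asm) sum_nonneg_eq_0_iff) auto
  then show ?thesis using xy by (simp add: m_def)
qed

section \<open>Equiangular lines\<close>

text \<open>Families rather than sets are used because values may repeat; two equal values already
  give a dependency with coefficients \<open>1\<close> and \<open>- 1\<close>.\<close>

lemma nontrivial_combination: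
  fixes f :: "'i \<Rightarrow> 'b::euclidean_space"
  assumes "finite I" "card I > DIM('b)"
  shows "\<exists>c. (\<exists>i\<in>I. c i \<noteq> 0) \<and> (\<Sum>i\<in>I. c i *\<^sub>R f i) = 0"
proof (cases "inj_on f I")
  case True
  then have "dependent (f ` I)"
    using assms by (intro dependent_biggerset) (simp_all add: card_image)
  then obtain u where u: "\<exists>v\<in>f ` I. u v \<noteq> 0" "(\<Sum>v\<in>f ` I. u v *\<^sub>R v) = 0"
    using assms(1) by (auto simp: dependent_finite)
  have "(\<Sum>i\<in>I. u (f i) *\<^sub>R f i) = 0"
    using u(2) by (simp add: sum.reindex[OF True])
  with u(1) show ?thesis by (intro exI[of _ "u \<circ> f"]) auto
next
  case False
  then obtain i j where ij: "i \<in> I" "j \<in> I" "i \<noteq> j" "f i = f j"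
    by (auto simp: inj_on_def)
  define c where "c k = (if k = i then 1 else if k = j then - 1 else 0 :: real)" for k
  have "(\<Sum>k\<in>I. c k *\<^sub>R f k) = (\<Sum>k\<in>{i, j}. c k *\<^sub>R f k)"
    using ij assms(1) by (intro sum.mono_neutral_right) (auto simp: c_def)
  also have "\<dots> = 0" using ij by (simp add: c_def)
  finally show ?thesis using ij by (intro exI[of _ c]) (auto simp: c_def)
qed

section \<open>Rational coordinates of real numbers\<close>

definition rational_functional :: "(real \<Rightarrow> real) \<Rightarrow> bool" where
  "rational_functional \<phi> \<longleftrightarrow> (\<forall>x y. \<phi> (x + y) = \<phi> x + \<phi> y) \<and>
     (\<forall>q\<in>\<rat>. \<forall>x. \<phi> (q * x) = q * \<phi> x) \<and> (\<forall>x. \<phi> x \<in> \<rat>) \<and> \<phi> 1 = 1"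

lemma rational_functionalD:
  assumes "rational_functional \<phi>"
  shows "\<phi> (x + y) = \<phi> x + \<phi> y" "q \<in> \<rat> \<Longrightarrow> \<phi> (q * x) = q * \<phi> x" "\<phi> x \<in> \<rat>" "\<phi> 1 = 1"
    "\<phi> 0 = 0" "\<phi> (- x) = - \<phi> x"
proof -
  show *: "q \<in> \<rat> \<Longrightarrow> \<phi> (q * x) = q * \<phi> x" for q x
    using assms by (simp add: rational_functional_def)
  show "\<phi> 0 = 0" "\<phi> (- x) = - \<phi> x" using *[of 0 0] *[of "- 1" x] by simp_all
qed (use assms in \<open>simp_all add: rational_functional_def\<close>)

lemma rational_functional_sum:
  assumes "rational_functional \<phi>"
  shows "\<phi> (\<Sum>i\<in>I. f i) = (\<Sum>i\<in>I. \<phi> (f i))"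
  by (induction I rule: infinite_finite_induct) (simp_all add: rational_functionalD[OF assms])

text \<open>The reals form a vector space over the rationals, and \<open>1\<close> can be completed
  to a basis. Applied to each coefficient, such a map preserves integer linear relations and turns
  real solutions into rational ones.\<close>

lemma ex_rational_functional: "\<exists>\<phi>. rational_functional \<phi>"
proof -
  interpret vector_space_pair "\<lambda>(q::rat) (x::real). of_rat q * x" "(*) :: rat \<Rightarrow> rat \<Rightarrow> rat"
    by unfold_locales (simp_all add: algebra_simps of_rat_add of_rat_mult)
  have "vs1.independent {1}" by simp
  then obtain g where g: "Vector_Spaces.linear (\<lambda>(q::rat) (x::real). of_rat q * x) (*) g" "g 1 = 1"
    using linear_independent_extend[of "{1}" "\<lambda>_. 1"] by blast
  interpret g: Vector_Spaces.linear "\<lambda>(q::rat) (x::real). of_rat q * x" "(*)" g by (rule g(1))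
  have "rational_functional (\<lambda>x. of_rat (g x))"
    unfolding rational_functional_def
  proof (intro conjI allI ballI)
    show "real_of_rat (g (x + y)) = of_rat (g x) + of_rat (g y)" for x y
      by (simp add: g.add of_rat_add)
    show "real_of_rat (g (q * x)) = q * of_rat (g x)" if "q \<in> \<rat>" for q x
      using that by (elim Rats_cases) (simp add: g.scale of_rat_mult)
  qed (simp_all add: g(2))
  then show ?thesis by blast
qed

section \<open>The sign matrix of equiangular lines and its eigenvectors\<close>

locale equiangular =
  fixes X :: "'a::euclidean_space set" and \<beta> :: real
  assumes fin: "finite X" and pos: "\<beta> > 0"
    and unit: "x \<in> X \<Longrightarrow> x \<bullet> x = 1"
    and angle: "\<lbrakk>x \<in> X; y \<in> X; x \<noteq> y\<rbrakk> \<Longrightarrow> \<beta> * (x \<bullet> y) = 1 \<or> \<beta> * (x \<bullet> y) = - 1"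
begin

text \<open>With \<open>G\<close> the Gram matrix of \<open>X\<close>, this is the Seidel-type
  matrix \<open>\<beta> * (G - I)\<close>. Integer entries let it act on rational vectors and be
  reduced modulo 2.\<close>

definition sign :: "'a \<Rightarrow> 'a \<Rightarrow> int" where
  "sign x y = (if x = y then 0 else if x \<bullet> y > 0 then 1 else - 1)"

lemma sign:
  assumes "x \<in> X" "y \<in> X" "x \<noteq> y"
  shows "of_int (sign x y) = \<beta> * (x \<bullet> y)"
proof -
  have "x \<bullet> y > 0 \<longleftrightarrow> \<beta> * (x \<bullet> y) > 0" using pos by (simp add: zero_less_mult_iff)
  then show ?thesis using angle[OF assms] assms(3) by (auto simp: sign_def)
qed

lemma sign_commute: "sign x y = sign y x"
  by (simp add: sign_def inner_commute)

lemma sign_square: "x \<noteq> y \<Longrightarrow> sign x y * sign x y = 1"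
  by (simp add: sign_def)

lemma sum_sign:
  assumes "x \<in> X"
  shows "(\<Sum>y\<in>X. of_int (sign x y) * c y) = \<beta> * (x \<bullet> (\<Sum>y\<in>X. c y *\<^sub>R y)) - \<beta> * c x"
proof -
  have "\<beta> * (x \<bullet> (\<Sum>y\<in>X. c y *\<^sub>R y)) = (\<Sum>y\<in>X. c y * (\<beta> * (x \<bullet> y)))"
    by (simp add: inner_sum_right sum_distrib_left mult_ac)
  also have "\<dots> = (\<Sum>y\<in>X. of_int (sign x y) * c y + (if y = x then \<beta> * c x else 0))"
    using assms by (intro sum.cong) (auto simp: sign unit, auto simp: sign_def)
  also have "\<dots> = (\<Sum>y\<in>X. of_int (sign x y) * c y) + \<beta> * c x"
    using assms fin by (simp add: sum.distrib)
  finally show ?thesis by simp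
qed

text \<open>A dependency between the vectors lies in the kernel of the Gram matrix, so the sign
  matrix multiplies it by \<open>- \<beta>\<close>.\<close>

lemma sum_sign_kernel:
  assumes "x \<in> X" "(\<Sum>y\<in>X. c y *\<^sub>R y) = 0"
  shows "(\<Sum>y\<in>X. of_int (sign x y) * c y) = - \<beta> * c x"
  using sum_sign[OF assms(1), of c] assms(2) by simp

lemma functional_sum_sign:
  assumes "rational_functional \<phi>"
  shows "\<phi> (\<Sum>y\<in>X. of_int (sign x y) * c y) = (\<Sum>y\<in>X. of_int (sign x y) * \<phi> (c y))"
  by (simp add: rational_functional_sum[OF assms] rational_functionalD(2)[OF assms])

text \<open>For irrational \<open>\<beta>\<close>, the map \<open>\<psi>\<close> below plays the role of the conjugation of
  \<open>\<rat>(\<beta>)\<close>: it carries linear dependencies between the vectors, which are eigenvectors of the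
  sign matrix for \<open>- \<beta>\<close>, to eigenvectors for \<open>\<beta>\<close>. If there are more than twice as many vectors
  as dimensions, the two eigenspaces meet.\<close>

lemma card_le_if_irrational:
  assumes irrat: "\<beta> \<notin> \<rat>" and sq: "\<beta>\<^sup>2 \<in> \<rat>"
  shows "card X \<le> 2 * DIM('a)"
proof (rule ccontr)
  assume large: "\<not> card X \<le> 2 * DIM('a)"
  obtain \<phi> where rf: "rational_functional \<phi>"
    using ex_rational_functional by blast
  note \<phi> = rational_functionalD[OF rf]
  define \<psi> where "\<psi> x = \<phi> (\<beta> * x) - \<beta> * \<phi> x" for x
  have "\<psi> 0 = 0" by (simp add: \<psi>_def \<phi>(5))
  have "\<psi> 1 \<noteq> 0"
    using irrat \<phi>(3)[of \<beta>] by (auto simp: \<psi>_def \<phi>(4))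
  \<comment> \<open>Since \<open>\<beta>\<^sup>2\<close> is rational,
    \<open>\<psi> (\<beta> * x) = - \<beta> * \<psi> x\<close>; being linear over the rationals,
    \<open>\<psi>\<close> also commutes with the integer sign matrix.\<close>
  have conj: "(\<Sum>y\<in>X. of_int (sign x y) * \<psi> (c y)) = \<beta> * \<psi> (c x)"
    if "x \<in> X" "(\<Sum>y\<in>X. c y *\<^sub>R y) = 0" for x c
  proof -
    have "(\<Sum>y\<in>X. of_int (sign x y) * \<phi> (\<beta> * c y)) = \<phi> (\<beta> * (\<Sum>y\<in>X. of_int (sign x y) * c y))"
      using functional_sum_sign[of \<phi> x "\<lambda>y. \<beta> * c y", OF rf]
      by (simp add: sum_distrib_left mult.left_commute)
    also have "\<dots> = - (\<beta>\<^sup>2 * \<phi> (c x))"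
      using \<phi>(2)[OF sq] by (simp add: sum_sign_kernel[OF that] \<phi>(6) power2_eq_square mult.assoc)
    finally have 1: "(\<Sum>y\<in>X. of_int (sign x y) * \<phi> (\<beta> * c y)) = - (\<beta>\<^sup>2 * \<phi> (c x))" .
    have 2: "(\<Sum>y\<in>X. of_int (sign x y) * \<phi> (c y)) = - \<phi> (\<beta> * c x)"
      using functional_sum_sign[of \<phi> x c, OF rf]
      by (simp add: sum_sign_kernel[OF that] \<phi>(6))
    have "(\<Sum>y\<in>X. of_int (sign x y) * \<psi> (c y)) = (\<Sum>y\<in>X. of_int (sign x y) * \<phi> (\<beta> * c y))
        - \<beta> * (\<Sum>y\<in>X. of_int (sign x y) * \<phi> (c y))"
      by (simp add: \<psi>_def right_diff_distrib sum_subtractf sum_distrib_left mult.left_commute)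
    then show ?thesis unfolding 1 2 by (simp add: \<psi>_def power2_eq_square algebra_simps)
  qed
  obtain B where B: "B \<subseteq> X" "independent B" "X \<subseteq> span B"
    using maximal_independent_subset[of X] by blast
  have "finite B" using B(1) fin by (rule finite_subset)
  have "card B \<le> DIM('a)" using B(2) independent_bound by blast
  have card: "card (X - B) > DIM('a)"
    using large \<open>card B \<le> DIM('a)\<close> B(1) \<open>finite B\<close> by (simp add: card_Diff_subset)
  \<comment> \<open>A basis of the space of dependencies: expressing each vector outside
    \<open>B\<close> through \<open>B\<close> gives one relation per element of
    \<open>X - B\<close>.\<close>
  have "\<exists>v. (\<Sum>y\<in>X. v y *\<^sub>R y) = 0 \<and> v j = 1 \<and> (\<forall>y\<in>X - B. y \<noteq> j \<longrightarrow> v y = 0)"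
    if j: "j \<in> X - B" for j
  proof -
    obtain u where u: "(\<Sum>b\<in>B. u b *\<^sub>R b) = j"
      using B(3) j \<open>finite B\<close> by (auto simp: span_finite)
    define v where "v y = (if y \<in> B then - u y else if y = j then 1 else 0)" for y
    have "(\<Sum>y\<in>X. v y *\<^sub>R y) = (\<Sum>y\<in>insert j B. v y *\<^sub>R y)"
      using fin B(1) j by (intro sum.mono_neutral_right) (auto simp: v_def)
    also have "\<dots> = j + (\<Sum>y\<in>B. v y *\<^sub>R y)"
      using \<open>finite B\<close> j by (simp add: v_def)
    also have "(\<Sum>y\<in>B. v y *\<^sub>R y) = - j"
      unfolding u[symmetric] sum_negf[symmetric] by (intro sum.cong) (auto simp: v_def)
    finally show ?thesis using j by (intro exI[of _ v]) (auto simp: v_def)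
  qed
  then have "\<exists>v. \<forall>j\<in>X - B. (\<Sum>y\<in>X. v j y *\<^sub>R y) = 0 \<and> v j j = 1 \<and>
      (\<forall>y\<in>X - B. y \<noteq> j \<longrightarrow> v j y = 0)"
    by (intro bchoice) blast
  then obtain v where "\<forall>j\<in>X - B. (\<Sum>y\<in>X. v j y *\<^sub>R y) = 0 \<and> v j j = 1 \<and>
      (\<forall>y\<in>X - B. y \<noteq> j \<longrightarrow> v j y = 0)"
    by (rule exE)
  then have v: "\<And>j. j \<in> X - B \<Longrightarrow> (\<Sum>y\<in>X. v j y *\<^sub>R y) = 0"
    "\<And>j. j \<in> X - B \<Longrightarrow> v j j = 1"
    "\<And>j y. \<lbrakk>j \<in> X - B; y \<in> X - B; y \<noteq> j\<rbrakk> \<Longrightarrow> v j y = 0"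
    by simp_all
  \<comment> \<open>More than \<open>DIM('a)\<close> vectors are dependent, so a nontrivial
    combination of the conjugated relations is again a dependency and satisfies the eigenvalue
    equations for both \<open>\<beta>\<close> and \<open>- \<beta>\<close>.\<close>
  obtain l k where l: "k \<in> X - B" "l k \<noteq> 0"
    "(\<Sum>j\<in>X - B. l j *\<^sub>R (\<Sum>y\<in>X. \<psi> (v j y) *\<^sub>R y)) = 0"
    using nontrivial_combination[OF finite_Diff[OF fin] card, of "\<lambda>j. \<Sum>y\<in>X. \<psi> (v j y) *\<^sub>R y"]
    by (elim exE conjE bexE) (rule that)
  define c where "c y = (\<Sum>j\<in>X - B. l j * \<psi> (v j y))" for y
  have "(\<Sum>y\<in>X. c y *\<^sub>R y) = (\<Sum>j\<in>X - B. l j *\<^sub>R (\<Sum>y\<in>X. \<psi> (v j y) *\<^sub>R y))"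
    unfolding c_def scaleR_sum_left scaleR_sum_right by (subst sum.swap) simp
  then have "(\<Sum>y\<in>X. c y *\<^sub>R y) = 0" using l(3) by simp
  then have "(\<Sum>y\<in>X. of_int (sign k y) * c y) = - \<beta> * c k"
    using l(1) by (intro sum_sign_kernel) auto
  moreover have "(\<Sum>y\<in>X. of_int (sign k y) * c y) =
      (\<Sum>j\<in>X - B. l j * (\<Sum>y\<in>X. of_int (sign k y) * \<psi> (v j y)))"
    unfolding c_def sum_distrib_left by (subst sum.swap) (simp add: mult.left_commute)
  moreover have "\<dots> = \<beta> * c k"
    using l(1) conj[OF _ v(1)] by (simp add: c_def sum_distrib_left mult.left_commute)
  ultimately have "c k = 0" using pos by simp
  \<comment> \<open>At \<open>k\<close> only the relation indexed by \<open>k\<close> has a nonzero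
    coefficient, so \<open>c k\<close> is the nonzero number \<open>l k * \<psi> 1\<close>.\<close>
  moreover have "c k = (\<Sum>j\<in>X - B. if j = k then l k * \<psi> 1 else 0)"
    unfolding c_def using l(1) v(2,3) \<open>\<psi> 0 = 0\<close> by (intro sum.cong) auto
  ultimately show False using l fin \<open>\<psi> 1 \<noteq> 0\<close> by simp
qed

text \<open>A primitive integral vector \<open>w\<close> with coefficient sum 0 satisfies the
  eigenvalue equation for \<open>- \<beta> = - a / b\<close>. It forces \<open>b\<close> to divide
  every \<open>w x\<close>; modulo 2 the sign matrix acts on \<open>w\<close> as the identity, so an
  even \<open>a\<close> would make every \<open>w x\<close> even.\<close>

lemma odd_if_rational:
  assumes rat: "\<beta> \<in> \<rat>" and card: "card X > DIM('a) + 1"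
  obtains p :: int where "odd p" "\<beta> = of_int p"
proof -
  \<comment> \<open>The added coordinate \<open>1\<close> forces the coefficients of the dependency
    to sum to 0; this accounts for the bound \<open>DIM('a) + 1\<close>.\<close>
  have "card X > DIM('a \<times> real)" using card by simp
  then obtain c k where c: "k \<in> X" "c k \<noteq> 0" "(\<Sum>y\<in>X. c y *\<^sub>R (y, 1::real)) = 0"
    using nontrivial_combination[OF fin, of "\<lambda>y. (y, 1::real)"] by blast
  \<comment> \<open>Normalised so that \<open>d k = 1\<close>: then \<open>\<phi> (d k) = 1\<close>,
    and the rational eigenvector is nonzero.\<close>
  define d where "d y = c y / c k" for y
  have "(\<Sum>y\<in>X. c y *\<^sub>R y) = 0" "(\<Sum>y\<in>X. c y) = 0"
    using c(3) by (auto simp: prod_eq_iff fst_sum snd_sum)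
  moreover have "(\<Sum>y\<in>X. d y *\<^sub>R y) = (1 / c k) *\<^sub>R (\<Sum>y\<in>X. c y *\<^sub>R y)"
    "(\<Sum>y\<in>X. d y) = (\<Sum>y\<in>X. c y) / c k"
    by (simp_all add: d_def scaleR_sum_right sum_divide_distrib)
  ultimately have d: "(\<Sum>y\<in>X. d y *\<^sub>R y) = 0" "(\<Sum>y\<in>X. d y) = 0" "d k = 1"
    using c(2) by (simp_all add: d_def)
  obtain \<phi> where rf: "rational_functional \<phi>"
    using ex_rational_functional by blast
  note \<phi> = rational_functionalD[OF rf]
  have 1: "(\<Sum>y\<in>X. of_int (sign x y) * \<phi> (d y)) = - \<beta> * \<phi> (d x)" if "x \<in> X" for x
    using functional_sum_sign[of \<phi> x d, OF rf] \<phi>(2)[OF rat]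
    by (simp add: sum_sign_kernel[OF that d(1)] \<phi>(6))
  have 2: "(\<Sum>y\<in>X. \<phi> (d y)) = 0"
    using rational_functional_sum[OF rf, of d X] d(2) \<phi>(5) by simp
  have "\<exists>r. \<phi> (d y) = of_rat r" for y
    using \<phi>(3)[of "d y"] by (auto elim: Rats_cases)
  then obtain r where r: "\<And>y. \<phi> (d y) = of_rat (r y)" by metis
  \<comment> \<open>Common denominator; scaling by \<open>D\<close> and then dividing by the gcd
    \<open>g\<close> yields the primitive vector \<open>w\<close>.\<close>
  define D where "D = (\<Prod>y\<in>X. snd (quotient_of (r y)))"
  have "D \<noteq> 0"
    using fin quotient_of_denom_pos' by (auto simp: D_def less_le)
  have "\<exists>z::int. of_int z = of_int D * r y" if "y \<in> X" for y
  proof -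
    obtain a b where ab: "quotient_of (r y) = (a, b)" by fastforce
    have "b dvd D" unfolding D_def
      using dvd_prodI[OF fin that, of "\<lambda>y. snd (quotient_of (r y))"] ab by simp
    then obtain e where "D = b * e" by auto
    moreover have "r y = of_int a / of_int b" using ab by (rule quotient_of_div)
    moreover have "b \<noteq> 0" using quotient_of_denom_pos[OF ab] by simp
    ultimately have "of_int (e * a) = of_int D * r y" by simp
    then show ?thesis by blast
  qed
  then obtain z :: "'a \<Rightarrow> int" where z: "\<And>y. y \<in> X \<Longrightarrow> of_int (z y) = of_int D * r y"
    by metis
  have z_real: "of_int (z y) = of_int D * \<phi> (d y)" if "y \<in> X" for y
    using arg_cong[OF z[OF that], of of_rat] by (simp add: of_rat_mult r)
  define g where "g = Gcd (z ` X)"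
  have "z k \<noteq> 0" using z_real[OF c(1)] d(3) \<phi>(4) \<open>D \<noteq> 0\<close> by auto
  then have "g \<noteq> 0" using c(1) by (auto simp: g_def)
  define w where "w y = z y div g" for y
  have zw: "z y = g * w y" if "y \<in> X" for y
    using that by (simp add: w_def g_def Gcd_dvd)
  have w_real: "of_int (w y) = of_int D / of_int g * \<phi> (d y)" if "y \<in> X" for y
    using z_real[OF that] zw[OF that] \<open>g \<noteq> 0\<close> by (simp add: field_simps)
  have primitive: "is_unit m" if "\<And>y. y \<in> X \<Longrightarrow> m dvd w y" for m
  proof -
    have "g * m dvd z y" if "y \<in> X" for y
      using that \<open>\<And>y. y \<in> X \<Longrightarrow> m dvd w y\<close> zw by simp
    then have "g * m dvd g" unfolding g_def by (intro Gcd_greatest) (auto simp: g_def)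
    then show ?thesis using \<open>g \<noteq> 0\<close> by (simp add: dvd_mult_cancel_left[of g m 1, simplified])
  qed
  have w1: "(\<Sum>y\<in>X. of_int (sign x y) * real_of_int (w y)) = - \<beta> * of_int (w x)"
    if "x \<in> X" for x
  proof -
    have "(\<Sum>y\<in>X. of_int (sign x y) * real_of_int (w y))
        = of_int D / of_int g * (\<Sum>y\<in>X. of_int (sign x y) * \<phi> (d y))"
      by (simp add: w_real sum_distrib_left mult_ac)
    then show ?thesis using that by (simp add: 1 w_real)
  qed
  have "real_of_int (\<Sum>y\<in>X. w y) = of_int D / of_int g * (\<Sum>y\<in>X. \<phi> (d y))"
    by (simp add: w_real sum_distrib_left)
  then have w2: "(\<Sum>y\<in>X. w y) = 0" by (simp only: 2 mult_zero_right of_int_eq_0_iff)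
  obtain a b :: int where ab: "b > 0" "coprime a b" "\<beta> = of_int a / of_int b"
    using rat by (rule Rats_cases')
  have w3: "b * (\<Sum>y\<in>X. sign x y * w y) = - (a * w x)" if "x \<in> X" for x
  proof -
    have "real_of_int (b * (\<Sum>y\<in>X. sign x y * w y)) = of_int (- (a * w x))"
      using w1[OF that] ab(1,3) by (simp add: field_simps)
    then show ?thesis by (simp only: of_int_eq_iff)
  qed
  have "b dvd w x" if "x \<in> X" for x
  proof -
    have "b dvd a * w x" using w3[OF that] by (metis dvd_minus_iff dvd_triv_left)
    then show ?thesis using ab(2) by (simp add: coprime_commute coprime_dvd_mult_right_iff)
  qed
  then have "b = 1" using primitive[of b] ab(1) by simp
  have "odd a"
  proof
    assume "even a"
    have "2 dvd w x" if "x \<in> X" for x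
    proof -
      have "even (\<Sum>y\<in>X. sign x y * w y)" using w3[OF that] \<open>b = 1\<close> \<open>even a\<close> by simp
      \<comment> \<open>Off-diagonal signs are odd and diagonal ones are 0, so every coefficient on
        the right is even.\<close>
      moreover have "(\<Sum>y\<in>X. w y) - (\<Sum>y\<in>X. sign x y * w y) - w x =
          (\<Sum>y\<in>X. (1 - sign x y - (if y = x then 1 else 0)) * w y)"
        using that fin by (simp add: left_diff_distrib sum_subtractf if_distrib[of "\<lambda>u. u * _"]
            cong: if_cong)
      moreover have "even (\<Sum>y\<in>X. (1 - sign x y - (if y = x then 1 else 0)) * w y)"
        by (intro dvd_sum) (auto simp: sign_def)
      ultimately have "even (- (\<Sum>y\<in>X. sign x y * w y) - w x)" using w2 by simp
      with \<open>even (\<Sum>y\<in>X. sign x y * w y)\<close> show ?thesis by simp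
    qed
    then show False using primitive[of 2] by simp
  qed
  then show ?thesis using that[of a] ab(3) \<open>b = 1\<close> by simp
qed

text \<open>Otherwise reversing some of the vectors makes all inner products equal to
  \<open>1 / \<beta>\<close>. The Gram matrix is then positive definite and the vectors are
  independent, which is impossible for more than \<open>DIM('a)\<close> of them.\<close>

lemma ex_negative_triple:
  assumes "\<beta> > 1" and card: "card X > DIM('a)"
  shows "\<exists>x\<in>X. \<exists>y\<in>X. \<exists>z\<in>X. x \<noteq> y \<and> y \<noteq> z \<and> x \<noteq> z \<and>
    sign x y * sign y z * sign x z = - 1"
proof (rule ccontr)
  assume "\<not> ?thesis"
  then have none: "\<forall>x\<in>X. \<forall>y\<in>X. x = y \<or> (\<forall>z\<in>X. y = z \<or> x = z \<or>
      sign x y * sign y z * sign x z \<noteq> - 1)"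
    by simp
  obtain c k where c: "k \<in> X" "c k \<noteq> 0" "(\<Sum>y\<in>X. c y *\<^sub>R y) = 0"
    using nontrivial_combination[OF fin card, of "\<lambda>y. y"] by blast
  \<comment> \<open>Reversal signs relative to the fixed vector \<open>k\<close>; without negative
    triples they factor the sign matrix off its diagonal.\<close>
  define e where "e x = (if x = k then 1 else sign k x)" for x
  have e_square: "e x * e x = 1" for x
    by (auto simp: e_def sign_def)
  have e: "sign x y = e x * e y" if "x \<in> X" "y \<in> X" "x \<noteq> y" for x y
  proof (cases "x = k \<or> y = k")
    case True
    then show ?thesis using that sign_commute[of x k] by (auto simp: e_def)
  next
    case False
    then have "sign k x * sign x y * sign k y \<noteq> - 1" 
      using none that c(1) by metis
    moreover have "sign k x = 1 \<or> sign k x = - 1" "sign x y = 1 \<or> sign x y = - 1"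
      "sign k y = 1 \<or> sign k y = - 1"
      using False that by (auto simp: sign_def)
    ultimately show ?thesis using False by (elim disjE) (simp_all add: e_def)
  qed
  define d where "d x = e x * c x" for x
  define S where "S = (\<Sum>y\<in>X. d y)"
  have d: "S + (\<beta> - 1) * d x = 0" if "x \<in> X" for x
  proof -
    have "(\<Sum>y\<in>X. of_int (sign x y) * c y) = (\<Sum>y\<in>X. e x * d y - (if y = x then c x else 0))"
    proof (intro sum.cong refl)
      fix y assume "y \<in> X"
      have "real_of_int (e x) * (real_of_int (e x) * c x) = c x"
        using arg_cong[OF e_square[of x], of real_of_int] by (simp flip: mult.assoc)
      then show "of_int (sign x y) * c y = e x * d y - (if y = x then c x else 0)"
        using e[OF that \<open>y \<in> X\<close>] by (cases "y = x") (simp_all add: d_def sign_def[of x x])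
    qed
    also have "\<dots> = e x * S - c x"
      using that fin by (simp add: sum_subtractf sum_distrib_left S_def)
    finally have "e x * S + (\<beta> - 1) * c x = 0"
      using sum_sign_kernel[OF that c(3)] by (simp add: algebra_simps)
    then have "e x * (e x * S + (\<beta> - 1) * c x) = 0" by simp
    then have "real_of_int (e x * e x) * S + (\<beta> - 1) * d x = 0"
      by (simp add: d_def algebra_simps)
    then show ?thesis by (simp add: e_square)
  qed
  \<comment> \<open>Adding up these equations gives \<open>S\<close> a positive factor, so
    \<open>S\<close> and then \<open>d k\<close> vanish.\<close>
  have "0 = (\<Sum>x\<in>X. S + (\<beta> - 1) * d x)" by (simp add: d)
  also have "\<dots> = (card X + (\<beta> - 1)) * S"
    by (simp add: sum.distrib flip: sum_distrib_left) (simp add: S_def algebra_simps)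
  finally have "S = 0" using assms by auto
  then have "d k = 0" using d[OF c(1)] assms by simp
  then show False using c(2) e_square[of k] by (auto simp: d_def)
qed

section \<open>Both orientations of the lines and negative triangles\<close>

definition signed :: "'a set" where "signed = X \<union> uminus ` X"

lemma finite_signed: "finite signed"
  and uminus_signed: "x \<in> signed \<Longrightarrow> - x \<in> signed"
  and unit_signed: "x \<in> signed \<Longrightarrow> x \<bullet> x = 1"
  using fin by (auto simp: signed_def unit)

lemma angle_signed:
  assumes "x \<in> signed" "y \<in> signed" "x \<noteq> y" "x \<noteq> - y"
  shows "\<beta> * (x \<bullet> y) = 1 \<or> \<beta> * (x \<bullet> y) = - 1"
proof -
  obtain x' y' where *: "x' \<in> X" "x = x' \<or> x = - x'" "y' \<in> X" "y = y' \<or> y = - y'"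
    using assms(1,2) by (auto simp: signed_def)
  then have "x' \<noteq> y'" using assms(3,4) by auto
  then show ?thesis using angle[of x' y'] * by auto
qed

lemma card_signed:
  assumes "\<beta> > 1"
  shows "card signed = 2 * card X"
proof -
  \<comment> \<open>Antipodal vectors in \<open>X\<close> would give
    \<open>\<beta> * (x \<bullet> y) = - \<beta>\<close>, which \<open>\<beta> > 1\<close>
    excludes.\<close>
  have "X \<inter> uminus ` X = {}"
  proof (rule ccontr)
    assume "X \<inter> uminus ` X \<noteq> {}"
    then obtain x where x: "x \<in> X" "- x \<in> X" by auto
    moreover have "x \<noteq> - x"
      using unit[OF x(1)] by (metis inner_minus_left equal_neg_zero zero_neq_one)
    ultimately show False using angle[of x "- x"] assms unit[OF x(1)] by auto
  qed
  then show ?thesis using fin by (simp add: signed_def card_Un_disjoint card_image)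
qed

text \<open>Reversing \<open>y\<close> and \<open>z\<close> where necessary makes both inner
  products with \<open>x\<close> negative; the product of the three signs is unaffected by
  reversals, so the third is negative too.\<close>

lemma ex_simplex:
  assumes "\<beta> > 1" "card X > DIM('a)"
  obtains p q r where "p \<in> signed" "q \<in> signed" "r \<in> signed"
    "\<beta> * (p \<bullet> q) = - 1" "\<beta> * (p \<bullet> r) = - 1" "\<beta> * (q \<bullet> r) = - 1"
proof -
  obtain x y z where xyz: "x \<in> X" "y \<in> X" "z \<in> X" "x \<noteq> y" "y \<noteq> z" "x \<noteq> z"
    "sign x y * sign y z * sign x z = - 1"
    using ex_negative_triple[OF assms] by blast
  let ?q = "- of_int (sign x y) *\<^sub>R y" and ?r = "- of_int (sign x z) *\<^sub>R z"
  show ?thesis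
  proof (rule that[of x ?q ?r])
    show "x \<in> signed" "?q \<in> signed" "?r \<in> signed" using xyz by (auto simp: signed_def sign_def)
    have "\<beta> * (x \<bullet> ?q) = - of_int (sign x y) * (\<beta> * (x \<bullet> y))" by simp
    also have "\<dots> = - of_int (sign x y * sign x y)"
      using xyz(1,2,4) by (simp flip: sign)
    finally show "\<beta> * (x \<bullet> ?q) = - 1" using xyz(4) by (simp add: sign_square)
    have "\<beta> * (x \<bullet> ?r) = - of_int (sign x z) * (\<beta> * (x \<bullet> z))" by simp
    also have "\<dots> = - of_int (sign x z * sign x z)"
      using xyz(1,3,6) by (simp flip: sign)
    finally show "\<beta> * (x \<bullet> ?r) = - 1" using xyz(6) by (simp add: sign_square)
    have "\<beta> * (?q \<bullet> ?r) = of_int (sign x y) * of_int (sign x z) * (\<beta> * (y \<bullet> z))" by simp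
    also have "\<dots> = of_int (sign x y * sign y z * sign x z)"
      using xyz(2,3,5) by (simp flip: sign)
    finally show "\<beta> * (?q \<bullet> ?r) = - 1" using xyz(7) by simp
  qed
qed

text \<open>The squared norm of \<open>p + q + r\<close> is \<open>3 - 6 / \<beta>\<close>.\<close>

lemma ge_2:
  assumes "\<beta> > 1" "card X > DIM('a)"
  shows "\<beta> \<ge> 2"
proof -
  obtain p q r where Y: "p \<in> signed" "q \<in> signed" "r \<in> signed"
    and angles: "\<beta> * (p \<bullet> q) = - 1" "\<beta> * (p \<bullet> r) = - 1" "\<beta> * (q \<bullet> r) = - 1"
    by (rule ex_simplex[OF assms])
  have "0 \<le> \<beta> * ((p + q + r) \<bullet> (p + q + r))" using pos by simp
  also have "\<dots> = 3 * \<beta> + 2 * (\<beta> * (p \<bullet> q) + \<beta> * (p \<bullet> r) + \<beta> * (q \<bullet> r))"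
    using Y by (simp add: inner_add_left inner_add_right unit_signed inner_commute algebra_simps)
  finally show ?thesis using angles by simp
qed

end

section \<open>Lines at angle \<open>arccos (1 / 3)\<close>\<close>

text \<open>Bessel's inequality: up to sign the vectors are orthogonal, and each axis carries at
  most two of them, which accounts for the factor 2.\<close>

lemma sum_inner_square_le:
  fixes C :: "'a::real_inner set"
  assumes fin: "finite C" and "r \<ge> 0" and norm: "\<And>c. c \<in> C \<Longrightarrow> c \<bullet> c = r"
    and orth: "\<And>c c'. \<lbrakk>c \<in> C; c' \<in> C; c \<noteq> c'\<rbrakk> \<Longrightarrow> c \<bullet> c' = 0 \<or> c' = - c"
  shows "(\<Sum>c\<in>C. (d \<bullet> c)\<^sup>2) \<le> 2 * r * (d \<bullet> d)"
proof -
  define w where "w = (\<Sum>c\<in>C. (d \<bullet> c) *\<^sub>R c)"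
  have dw: "d \<bullet> w = (\<Sum>c\<in>C. (d \<bullet> c)\<^sup>2)"
    by (simp add: w_def inner_sum_right power2_eq_square)
  have "w \<bullet> c * (d \<bullet> c) \<le> 2 * r * (d \<bullet> c)\<^sup>2" if "c \<in> C" for c
  proof -
    have "w \<bullet> c = (\<Sum>c'\<in>C. (d \<bullet> c') * (c' \<bullet> c))" by (simp add: w_def inner_sum_left)
    also have "\<dots> = (\<Sum>c'\<in>C \<inter> {c, - c}. (d \<bullet> c') * (c' \<bullet> c))"
      using orth[OF that] by (intro sum.mono_neutral_right fin) (auto simp: inner_commute)
    also have "\<dots> = (\<Sum>c'\<in>C \<inter> {c, - c}. (d \<bullet> c) * r)"
      using norm[OF that] by (intro sum.cong) auto
    finally have "w \<bullet> c * (d \<bullet> c) = real (card (C \<inter> {c, - c})) * (r * (d \<bullet> c)\<^sup>2)"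
      by (simp add: power2_eq_square)
    moreover have "card (C \<inter> {c, - c}) \<le> 2"
      using card_mono[of "{c, - c}" "C \<inter> {c, - c}"] card_insert_le_m1[of 2 "{- c}" c] by simp
    ultimately show ?thesis using \<open>r \<ge> 0\<close> by (simp add: mult_right_mono mult.assoc)
  qed
  moreover have "w \<bullet> w = (\<Sum>c\<in>C. w \<bullet> c * (d \<bullet> c))"
    by (subst (2) w_def) (simp add: inner_sum_right mult.commute)
  ultimately have "w \<bullet> w \<le> 2 * r * (d \<bullet> w)"
    unfolding dw sum_distrib_left by (metis (no_types, lifting) sum_mono)
  \<comment> \<open>Together with the bound on \<open>w \<bullet> w\<close>, nonnegativity of this
    square yields the claim after division by \<open>2 * r\<close>; the case \<open>r = 0\<close> is
    separate.\<close>
  moreover have "0 \<le> (w - (2 * r) *\<^sub>R d) \<bullet> (w - (2 * r) *\<^sub>R d)" by simp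
  ultimately have "0 \<le> 2 * r * (2 * r * (d \<bullet> d) - d \<bullet> w)"
    by (simp add: inner_diff_left inner_diff_right inner_commute algebra_simps)
  moreover have "(\<Sum>c\<in>C. (d \<bullet> c)\<^sup>2) = 0" if "r = 0"
  proof (intro sum.neutral ballI)
    fix c assume "c \<in> C"
    then have "c = 0" using norm[of c] that by simp
    then show "(d \<bullet> c)\<^sup>2 = 0" by simp
  qed
  ultimately show ?thesis
    using \<open>r \<ge> 0\<close> by (cases "r = 0") (simp_all add: zero_le_mult_iff dw)
qed

text \<open>This is the argument of Lemmens and Seidel. If \<open>p, q, r\<close>
  have mutual inner products \<open>- 1 / 3\<close>, then so have \<open>p, q, r, - (p + q + r)\<close>, and up to sign every
  further vector has the same projection onto their span as one of three orthogonal vectors \<open>h\<close>. The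
  vectors with a given \<open>h\<close> form a pillar.\<close>

locale equiangular_3 = equiangular X 3 for X :: "'a::euclidean_space set"
begin

lemma angle_3:
  assumes "x \<in> signed" "y \<in> signed" "x \<noteq> y" "x \<noteq> - y"
  shows "x \<bullet> y = 1 / 3 \<or> x \<bullet> y = - 1 / 3"
  using angle_signed[OF assms] by auto

text \<open>The vectors \<open>t - h\<close> have squared norm 2/3, and their mutual inner products
  are \<open>t \<bullet> u - 1 / 3\<close>, so 0 or -2/3; in the second case they are opposite, and
  the Bessel bound applies.\<close>

lemma pillar:
  assumes P: "P \<subseteq> signed" "\<And>t. t \<in> P \<Longrightarrow> t \<bullet> h = 1 / 3" and h: "h \<bullet> h = 1 / 3"
  shows "(\<Sum>t\<in>P. (d \<bullet> (t - h))\<^sup>2) \<le> 4 / 3 * (d \<bullet> d)"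
proof -
  have norm: "(t - h) \<bullet> (t - h) = 2 / 3" if "t \<in> P" for t
    using P(2)[OF that] P(1) that h unit_signed[of t]
    by (auto simp: inner_diff_left inner_diff_right inner_commute[of h t])
  have orth: "(t - h) \<bullet> (u - h) = 0 \<or> u - h = - (t - h)" if "t \<in> P" "u \<in> P" "t \<noteq> u" for t u
  proof -
    have "t \<noteq> - u" using P(2)[OF that(1)] P(2)[OF that(2)] by auto
    then have "t \<bullet> u = 1 / 3 \<or> t \<bullet> u = - 1 / 3" using that P(1) by (intro angle_3) auto
    moreover have tu: "(t - h) \<bullet> (u - h) = t \<bullet> u - 1 / 3"
      using P(2)[OF that(1)] P(2)[OF that(2)] h
      by (simp add: inner_diff_left inner_diff_right inner_commute[of h u])
    moreover have "((t - h) + (u - h)) \<bullet> ((t - h) + (u - h)) = 4 / 3 + 2 * ((t - h) \<bullet> (u - h))"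
      unfolding inner_add_left[of "t - h"] inner_add_right[of _ "t - h"]
      using norm[OF that(1)] norm[OF that(2)] by (simp add: inner_commute)
    ultimately have "(t - h) \<bullet> (u - h) = 0 \<or> ((t - h) + (u - h)) \<bullet> ((t - h) + (u - h)) = 0"
      by auto
    then show ?thesis unfolding inner_eq_zero_iff using minus_unique[of "t - h" "u - h"] by metis
  qed
  have "finite P" using P(1) finite_signed by (rule finite_subset)
  have "(\<Sum>t\<in>P. (d \<bullet> (t - h))\<^sup>2) = (\<Sum>c\<in>(\<lambda>t. t - h) ` P. (d \<bullet> c)\<^sup>2)"
    by (subst sum.reindex) (auto simp: inj_on_def)
  also have "\<dots> \<le> 2 * (2 / 3) * (d \<bullet> d)"
  proof (rule sum_inner_square_le)
    show "c \<bullet> c = 2 / 3" if "c \<in> (\<lambda>t. t - h) ` P" for c using that norm by blast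
    show "c \<bullet> c' = 0 \<or> c' = - c" if "c \<in> (\<lambda>t. t - h) ` P" "c' \<in> (\<lambda>t. t - h) ` P" "c \<noteq> c'" for c c'
      using that orth by blast
  qed (use \<open>finite P\<close> in simp_all)
  finally show ?thesis by simp
qed

text \<open>Let \<open>d\<close> run through an orthonormal basis in \<open>pillar\<close> and add
  up.\<close>

lemma card_pillar:
  assumes P: "P \<subseteq> signed" "\<And>t. t \<in> P \<Longrightarrow> t \<bullet> h = 1 / 3" and h: "h \<bullet> h = 1 / 3"
  shows "card P \<le> 2 * DIM('a)"
proof -
  have norm_square: "v \<bullet> v = (\<Sum>b\<in>Basis. (b \<bullet> v)\<^sup>2)" for v :: 'a
    by (subst euclidean_inner) (simp add: power2_eq_square inner_commute)
  have "2 / 3 * real (card P) = (\<Sum>t\<in>P. (t - h) \<bullet> (t - h))"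
  proof -
    have "(t - h) \<bullet> (t - h) = 2 / 3" if "t \<in> P" for t
      using P(2)[OF that] P(1) that h unit_signed[of t]
    by (auto simp: inner_diff_left inner_diff_right inner_commute[of h t])
    then have "(\<Sum>t\<in>P. (t - h) \<bullet> (t - h)) = (\<Sum>t\<in>P. 2 / 3)" by (intro sum.cong refl)
    then show ?thesis by simp
  qed
  also have "\<dots> = (\<Sum>t\<in>P. \<Sum>b\<in>Basis. (b \<bullet> (t - h))\<^sup>2)"
    unfolding norm_square ..
  also have "\<dots> = (\<Sum>b\<in>Basis. \<Sum>t\<in>P. (b \<bullet> (t - h))\<^sup>2)" by (rule sum.swap)
  also have "\<dots> \<le> (\<Sum>b::'a\<in>Basis. 4 / 3 * (b \<bullet> b))"
    by (intro sum_mono pillar assms)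
  also have "\<dots> = 4 / 3 * real DIM('a)" by simp
  finally show ?thesis by simp
qed

text \<open>A vector \<open>u\<close> of another pillar gives the test vector
  \<open>d = u - h'\<close>, of squared norm 2/3, whose inner product with every
  \<open>t - h\<close> is 1/3 or -1/3; hence \<open>card P / 9 \<le> 8 / 9\<close>.\<close>

lemma card_pillar_if_two:
  assumes P: "P \<subseteq> signed" "\<And>t. t \<in> P \<Longrightarrow> t \<bullet> h = 1 / 3" and h: "h \<bullet> h = 1 / 3"
    and u: "u \<in> signed" "u \<bullet> h' = 1 / 3" "u \<bullet> h = 0" and h': "h' \<bullet> h' = 1 / 3" "h \<bullet> h' = 0"
    and P': "\<And>t. t \<in> P \<Longrightarrow> t \<bullet> h' = 0"
  shows "card P \<le> 8"
proof -
  have "((u - h') \<bullet> (t - h))\<^sup>2 = 1 / 9" if "t \<in> P" for t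
  proof -
    have "t \<noteq> u" "t \<noteq> - u" using P(2)[OF that] u(3) by auto
    then have "u \<bullet> t = 1 / 3 \<or> u \<bullet> t = - 1 / 3"
      using that P(1) u(1) by (subst (1 2) inner_commute, intro angle_3) auto
    moreover have "(u - h') \<bullet> (t - h) = u \<bullet> t"
      using P'[OF that] u(3) h'(2) by (simp add: inner_diff_left inner_diff_right inner_commute)
    moreover have "x\<^sup>2 = 1 / 9" if "x = 1 / 3 \<or> x = - 1 / 3" for x :: real
      using that by (elim disjE; hypsubst; simp add: power2_eq_square)
    ultimately show ?thesis by metis
  qed
  then have "(\<Sum>t\<in>P. ((u - h') \<bullet> (t - h))\<^sup>2) = (\<Sum>t\<in>P. 1 / 9)" by (intro sum.cong refl)
  then have "real (card P) / 9 = (\<Sum>t\<in>P. ((u - h') \<bullet> (t - h))\<^sup>2)" by simp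
  also have "\<dots> \<le> 4 / 3 * ((u - h') \<bullet> (u - h'))" by (rule pillar[OF P h])
  also have "(u - h') \<bullet> (u - h') = 2 / 3"
    using u h' unit_signed[of u] by (simp add: inner_diff_left inner_diff_right inner_commute)
  finally show ?thesis by simp
qed

text \<open>If at most one pillar is nonempty, it has at most \<open>2 * DIM('a)\<close> vectors;
  otherwise each of the three has at most 8. The lines of \<open>p, q, r, s\<close> add at most
  4.\<close>

lemma card_le:
  assumes "card X > DIM('a)"
  shows "card X \<le> max 28 (2 * DIM('a) + 4)"
proof -
  obtain p q r where Y: "p \<in> signed" "q \<in> signed" "r \<in> signed"
    and angles: "p \<bullet> q = - 1 / 3" "p \<bullet> r = - 1 / 3" "q \<bullet> r = - 1 / 3"
    using ex_simplex[OF _ assms] by (auto simp: field_simps)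
  define s where "s = - (p + q + r)"
  \<comment> \<open>Half sums of two of the four vectors; the complementary pair has the opposite
    half sum, as \<open>p + q + r + s = 0\<close>.\<close>
  define h where "h i = (if i = 0 then q + r else if i = 1 then p + r else p + q) /\<^sub>R 2" for i :: nat
  have sq: "p \<bullet> p = 1" "q \<bullet> q = 1" "r \<bullet> r = 1" "q \<bullet> p = - 1 / 3" "r \<bullet> p = - 1 / 3" "r \<bullet> q = - 1 / 3"
    using Y unit_signed angles by (auto simp: inner_commute)
  have h: "h i \<bullet> h i = 1 / 3" for i
    by (simp add: h_def inner_add_left inner_add_right sq angles)
  have hh: "h i \<bullet> h j = 0" if "i < 3" "j < 3" "i \<noteq> j" for i j
  proof -
    have "i = 0 \<or> i = 1 \<or> i = 2" "j = 0 \<or> j = 1 \<or> j = 2" using that by linarith+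
    then show ?thesis using that(3)
      by (elim disjE) (simp_all add: h_def inner_add_left inner_add_right sq angles)
  qed
  define P where "P i = {t \<in> signed. t \<bullet> h i = 1 / 3 \<and> (\<forall>j<3. j \<noteq> i \<longrightarrow> t \<bullet> h j = 0)}" for i
  have PY: "P i \<subseteq> signed" for i by (auto simp: P_def)
  then have finP: "finite (P i)" for i using finite_signed by (rule finite_subset)
  define A where "A = P 0 \<union> P 1 \<union> P 2"
  have "signed \<subseteq> {p, q, r, s} \<union> uminus ` {p, q, r, s} \<union> (A \<union> uminus ` A)"
  proof
    fix t assume t: "t \<in> signed"
    show "t \<in> {p, q, r, s} \<union> uminus ` {p, q, r, s} \<union> (A \<union> uminus ` A)"
    proof (cases "t \<in> {p, q, r} \<union> uminus ` {p, q, r}")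
      case True
      then show ?thesis by auto
    next
      case False
      have s: "s \<bullet> s = 1"
        by (simp add: s_def inner_add_left inner_add_right inner_diff_left inner_diff_right sq angles)
      have t_s: "t = s \<or> t = - s" if "t \<bullet> s = 1 \<or> t \<bullet> s = - 1"
      proof -
        have "(t - s) \<bullet> (t - s) = 2 - 2 * (t \<bullet> s)" "(t + s) \<bullet> (t + s) = 2 + 2 * (t \<bullet> s)"
          using s unit_signed[OF t]
          by (simp_all add: inner_diff_left inner_diff_right inner_add_left inner_add_right inner_commute)
        then have "(t - s) \<bullet> (t - s) = 0 \<or> (t + s) \<bullet> (t + s) = 0" using that by auto
        then show ?thesis by (auto simp: eq_neg_iff_add_eq_0)
      qed
      have ts: "t \<bullet> s = - (t \<bullet> p + t \<bullet> q + t \<bullet> r)" by (simp add: s_def inner_diff_right)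
      have mem: "t \<in> A \<or> - t \<in> A" 
        if *: "\<exists>i<3. (t \<bullet> h i = 1 / 3 \<or> t \<bullet> h i = - 1 / 3) \<and>
          (\<forall>j<3. j \<noteq> i \<longrightarrow> t \<bullet> h j = 0)"
      proof -
        obtain i where i: "i < 3" "t \<bullet> h i = 1 / 3 \<or> t \<bullet> h i = - 1 / 3" "\<forall>j<3. j \<noteq> i \<longrightarrow> t \<bullet> h j = 0"
          using * by blast
        then have "t \<in> P i \<or> - t \<in> P i" using t by (auto simp: P_def uminus_signed)
        moreover have "i = 0 \<or> i = 1 \<or> i = 2" using i(1) by linarith
        ultimately show ?thesis by (auto simp: A_def)
      qed
      have th: "t \<bullet> h 0 = (t \<bullet> q + t \<bullet> r) / 2" "t \<bullet> h 1 = (t \<bullet> p + t \<bullet> r) / 2"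
        "t \<bullet> h 2 = (t \<bullet> p + t \<bullet> q) / 2"
        by (simp_all add: h_def inner_add_right)
      have three: "(\<forall>j<3. Q j) \<longleftrightarrow> Q 0 \<and> Q 1 \<and> Q 2"
        "(\<exists>j<3. Q j) \<longleftrightarrow> Q 0 \<or> Q 1 \<or> Q 2" for Q :: "nat \<Rightarrow> bool"
        by (auto simp: numeral_3_eq_3 less_Suc_eq numeral_2_eq_2)
      have "t \<bullet> p = 1 / 3 \<or> t \<bullet> p = - 1 / 3" "t \<bullet> q = 1 / 3 \<or> t \<bullet> q = - 1 / 3"
        "t \<bullet> r = 1 / 3 \<or> t \<bullet> r = - 1 / 3"
        using False t Y by (intro angle_3; force)+
      \<comment> \<open>If the three inner products have equal signs, \<open>t \<bullet> s\<close>
        is 1 or -1; otherwise the two that agree single out the index \<open>i\<close> with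
        \<open>t \<bullet> h i \<noteq> 0\<close>.\<close>
      then have "t = s \<or> t = - s \<or> t \<in> A \<or> - t \<in> A"
        using t_s ts mem unfolding three th
        by (elim disjE) (simp_all, blast+)
      then show ?thesis by (auto simp: image_iff) (metis minus_minus)
    qed
  qed
  then have "card signed \<le> card ({p, q, r, s} \<union> uminus ` {p, q, r, s} \<union> (A \<union> uminus ` A))"
    by (intro card_mono) (auto simp: A_def finP)
  also have "\<dots> \<le> (4 + 4) + (card A + card A)"
  proof -
    have "card {p, q, r, s} \<le> 4" using card_length[of "[p, q, r, s]"] by simp
    moreover from this have "card (uminus ` {p, q, r, s}) \<le> 4"
      by (intro order_trans[OF card_image_le]) auto
    moreover have "card (uminus ` A) \<le> card A" by (intro card_image_le) (simp add: A_def finP)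
    ultimately show ?thesis
      by (intro order_trans[OF card_Un_le] add_mono) auto
  qed
  finally have "card X \<le> 4 + card A" using card_signed by simp
  moreover have "card A \<le> card (P 0) + card (P 1) + card (P 2)"
    unfolding A_def by (intro order_trans[OF card_Un_le] add_mono order_refl)
  moreover have one: "card (P i) \<le> 2 * DIM('a)" for i
    by (rule card_pillar[OF PY _ h]) (auto simp: P_def)
  have two: "P j = {} \<or> card (P i) \<le> 8" if ij: "i < 3" "j < 3" "i \<noteq> j" for i j
  proof (cases "P j = {}")
    case False
    then obtain u where "u \<in> P j" by blast
    then show ?thesis
      using ij h hh[of i j] by (intro disjI2 card_pillar_if_two[of "P i" "h i" u "h j"]) (auto simp: P_def)
  qed simp
  ultimately show ?thesis
    using one[of 0] one[of 1] one[of 2]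
      two[of 0 1] two[of 0 2] two[of 1 0] two[of 1 2] two[of 2 0] two[of 2 1]
    by (cases "P 0 = {}"; cases "P 1 = {}"; cases "P 2 = {}") auto
qed

end

section \<open>Classification of tight designs of harmonic index four\<close>

theorem theorem5:
  fixes X :: "(real ^ 'n::finite) set"
  assumes "CARD('n) \<ge> 2"
    and "tight_harmonic_index_design 4 X"
  shows "CARD('n) = 2 \<or> (\<exists>p::int. odd p \<and> p \<ge> 5 \<and> int CARD('n) = 3 * p ^ 2 - 4)"
proof (cases "CARD('n) = 2")
  case False
  define n where "n = CARD('n)"
  have n: "n \<ge> 3" using assms(1) False by (simp add: n_def)
  define \<beta> where "\<beta> = sqrt ((real n + 4) / 3)"
  have \<beta>_square: "\<beta>\<^sup>2 = (real n + 4) / 3" by (simp add: \<beta>_def)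
  have "\<beta> > 1" using n by (simp add: \<beta>_def)
  have design: "finite X" "\<And>x. x \<in> X \<Longrightarrow> norm x = 1" "real (card X) = b_const n 4"
    using assms(2)
    by (auto simp: tight_harmonic_index_design_def harmonic_index_design_def n_def)
  have "real (6 * card X) = real ((n + 1) * (n + 2))"
    using design(3) n by (simp add: b_const_4 algebra_simps)
  then have "6 * card X = (n + 1) * (n + 2)" by (simp only: of_nat_eq_iff)
  then have card: "6 * card X = n * n + 3 * n + 2" by simp
  have dim: "DIM(real ^ 'n) = n" by (simp add: n_def)
  interpret equiangular X \<beta>
  proof
    show "x \<bullet> x = 1" if "x \<in> X" for x using design(2)[OF that] by (simp add: dot_square_norm)
    show "\<beta> * (x \<bullet> y) = 1 \<or> \<beta> * (x \<bullet> y) = - 1" if "x \<in> X" "y \<in> X" "x \<noteq> y" for x y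
    proof -
      have "(x \<bullet> y)\<^sup>2 = 3 / (real n + 4)"
        using tight_harmonic_index_4_design_inner[OF _ assms(2) that] n by (simp add: n_def)
      then have "(\<beta> * (x \<bullet> y))\<^sup>2 = 1" by (simp add: power_mult_distrib \<beta>_square)
      then show ?thesis by (simp add: power2_eq_1_iff)
    qed
  qed (use design(1) \<open>\<beta> > 1\<close> in simp_all)
  have "n * n \<ge> 3 * n" using n by simp
  then have "card X > n" using card n by linarith
  then have "\<beta> \<ge> 2" using \<open>\<beta> > 1\<close> dim by (intro ge_2) simp_all
  then have "\<beta>\<^sup>2 \<ge> 2\<^sup>2" by (intro power_mono) simp_all
  then have "n \<ge> 8" by (simp add: \<beta>_square)
  have "\<beta> \<in> \<rat>"
  proof (rule ccontr)
    assume irrational: "\<beta> \<notin> \<rat>"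
    have "\<beta>\<^sup>2 \<in> \<rat>" by (simp add: \<beta>_square)
    with irrational have "card X \<le> 2 * n" using card_le_if_irrational dim by simp
    \<comment> \<open>At \<open>n = 8\<close> there are 15 lines, which does not exceed
      \<open>2 * n\<close>, but there \<open>\<beta> = 2\<close> is rational.\<close>
    moreover have "n \<noteq> 8"
    proof
      assume "n = 8"
      then have "\<beta> = 2" by (simp add: \<beta>_def)
      then show False using irrational by simp
    qed
    then have "n \<ge> 9" using \<open>n \<ge> 8\<close> by simp
    moreover from this have "n * n \<ge> 9 * n" by simp
    ultimately show False using card by linarith
  qed
  have "n * n \<ge> 8 * n" using \<open>n \<ge> 8\<close> by simp
  then have "card X > n + 1" using card \<open>n \<ge> 8\<close> by linarith
  then obtain p :: int where p: "odd p" "\<beta> = of_int p"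
    using odd_if_rational[OF \<open>\<beta> \<in> \<rat>\<close>] dim by auto
  have "real_of_int (int n) = real_of_int (3 * p\<^sup>2 - 4)"
    using \<beta>_square p(2) by simp
  then have np: "int n = 3 * p\<^sup>2 - 4" by (simp only: of_int_eq_iff)
  have "p \<noteq> 3"
  proof
    assume "p = 3"
    then have "equiangular_3 X"
      using equiangular_axioms p(2) by (simp add: equiangular_3_def)
    moreover have "n = 23" using np \<open>p = 3\<close> by simp
    ultimately show False
      using equiangular_3.card_le[of X] card dim by simp
  qed
  moreover have "p \<ge> 2" using \<open>\<beta> \<ge> 2\<close> p(2) by simp
  moreover have "p \<noteq> 2" "p \<noteq> 4" using p(1) by auto
  ultimately have "p \<ge> 5" by linarith
  then show ?thesis using p(1) np by (auto simp: n_def)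
qed simp

end
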